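(* Let $d\ge 1$ and $r>0$. For any Borel set $A\subset\mathbb{R}^d$, with $A_r=A+rB_2^d$, we have $$\gamma_d^+(\partial A_r)\;\leq\;18\,d\,\max\left(\sqrt{d},\,r^{-1}\right).$$
   Context: For sets $A,B\subset\mathbb{R}^d$, the Minkowski sum is $A+B=\{a+b:\ a\in A,\ b\in B\}$. $B_2^d$ denotes the closed unit Euclidean ball in $\mathbb{R}^d$, and $A_r=A+rB_2^d$ for $r>0$. $\gamma_d$ denotes the standard Gaussian measure on $\mathbb{R}^d$, i.e. the measure with density $(2\pi)^{-d/2}e^{-|x|^2/2}$, where $|x|$ is the Euclidean norm. The upper Gaussian surface area of a measurable set $E\subset\mathbb{R}^d$ is $$\gamma_d^+(\partial E)=\limsup_{\varepsilon\to0^+}\frac{\gamma_d(E+\varepsilon B_2^d)-\gamma_d(E)}{\varepsilon}.$$ In the claim this is applied to $E=A_r$. *)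

theory Defs
  imports "HOL-Analysis.Analysis"
begin

(* The density is taken over the completed measure lebesgue, not over lborel: the sum of a Borel
   set and a closed ball is Lebesgue measurable but need not be Borel, and measure is 0 by
   convention outside the sigma-algebra. *)
definition std_gaussian :: "(real ^ 'n::finite) measure" where
  "std_gaussian = density lebesgue
     (\<lambda>x. ennreal ((2 * pi) powr (- real CARD('n) / 2) * exp (- (norm x)\<^sup>2 / 2)))"

(* A + r B, where B is the closed Euclidean unit ball; "+" is the Minkowski sum of
   HOL-Library.Set_Algebras. *)
definition parallel_set :: "(real ^ 'n::finite) set \<Rightarrow> real \<Rightarrow> (real ^ 'n) set" where
  "parallel_set A r = A + (\<lambda>x. r *\<^sub>R x) ` cball 0 1"

(* Extended-real valued, so that an infinite upper limit is represented as such. *)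
definition gaussian_upper_surface_area :: "(real ^ 'n::finite) set \<Rightarrow> ereal" where
  "gaussian_upper_surface_area E =
     Limsup (at_right 0) (\<lambda>\<epsilon>::real. ereal
       ((measure std_gaussian (parallel_set E \<epsilon>) - measure std_gaussian E) / \<epsilon>))"

end

theory Submission
  imports Defs "HOL-Probability.Distributions"
begin

text \<open>The Gaussian mass of a neighbourhood of \<open>A\<close> cannot grow fast with its radius, because a
neighbourhood of radius \<open>r + \<epsilon>\<close> can be contracted into the one of radius \<open>r\<close> while losing little mass:
move every point \<open>x\<close> towards its nearest point \<open>p\<close> of \<open>A\<close>, to \<open>p + c (x - p)\<close> with \<open>c = r / (r + \<epsilon>)\<close>.
This is Kneser's argument for the growth of the volume of parallel sets, carried out with a Gaussian
weight. In dimension \<open>d\<close> the Jacobian is \<open>c ^ d \<ge> 1 - \<epsilon> d / r\<close>. No point moves farther than \<open>\<epsilon>\<close>, so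
the density shrinks at most by the factor \<open>exp (- \<epsilon> |x| - \<epsilon>\<^sup>2 / 2)\<close>. Averaging, with \<open>E |x| \<le> sqrt d\<close>,
the mass grows by at most \<open>\<epsilon> (d / r + sqrt d + \<epsilon> / 2)\<close>, and the surface area is at most
\<open>d / r + sqrt d\<close>, which is well below the claimed bound.

If \<open>A\<close> is finite, the contraction is affine on each Voronoi cell and keeps the cell invariant, as cells
are star-shaped about their centres; the comparison of masses is then the affine change of variables,
cell by cell (\<open>star_shaped_gaussian_growth\<close>, \<open>finite_union_balls_gaussian_growth\<close>). For arbitrary \<open>A\<close>,
the open neighbourhood is an increasing limit of finite unions of balls
(\<open>open_nbhd_gaussian_growth\<close>). The same estimate shows that open and closed neighbourhoods of equal
radius differ by a null set (\<open>parallel_set_boundary_null\<close>), which transfers the bound to parallel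
sets.\<close>

section \<open>The standard Gaussian measure and its moments\<close>

definition gauss_density :: "(real ^ 'n::finite) \<Rightarrow> real" where
  "gauss_density x = (2 * pi) powr (- real CARD('n) / 2) * exp (- (norm x)\<^sup>2 / 2)"

lemma gauss_density_pos: "gauss_density x > 0"
  by (simp add: gauss_density_def)

lemma gauss_density_measurable [measurable]:
  "gauss_density \<in> borel_measurable borel"
  unfolding gauss_density_def by measurable

lemma sets_std_gaussian: "sets std_gaussian = sets lebesgue"
  by (simp add: std_gaussian_def)

lemma space_std_gaussian: "space std_gaussian = UNIV"
  by (simp add: std_gaussian_def)

lemma borel_measurable_std_gaussian:
  assumes "f \<in> borel_measurable borel"
  shows "f \<in> borel_measurable std_gaussian"
  using assms unfolding std_gaussian_def
  by (simp add: measurable_completion)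

lemma borel_set_std_gaussian: "S \<in> sets borel \<Longrightarrow> S \<in> sets std_gaussian"
  by (simp add: sets_std_gaussian)

text \<open>Since the density is positive, completing and weighting commute. Hence integrals of Borel
functions can be computed over \<^term>\<open>lborel\<close>, and every subset of a Gaussian null set is measurable.\<close>

lemma std_gaussian_eq_completion:
  "std_gaussian = completion (density lborel (\<lambda>x. ennreal (gauss_density x)))"
  unfolding std_gaussian_def gauss_density_def[symmetric]
  by (rule completion_density_eq[symmetric]) (simp_all add: gauss_density_pos)

lemma nn_integral_std_gaussian:
  assumes "f \<in> borel_measurable borel"
  shows "(\<integral>\<^sup>+x. f x \<partial>std_gaussian) = (\<integral>\<^sup>+x. ennreal (gauss_density x) * f x \<partial>lborel)"
  using assms
  by (simp add: std_gaussian_eq_completion nn_integral_completion nn_integral_density)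

lemma norm_power2_eq_sum_Basis: "(norm x)\<^sup>2 = (\<Sum>b\<in>Basis. (x \<bullet> b)\<^sup>2)"
  unfolding power2_norm_eq_inner by (subst euclidean_inner) (simp add: power2_eq_square)

lemma gauss_density_eq_prod:
  "gauss_density (x :: real ^ 'n::finite) = (\<Prod>b\<in>Basis. std_normal_density (x \<bullet> b))"
proof -
  have "(2 * pi) powr (- real CARD('n) / 2) = (1 / sqrt (2 * pi)) ^ CARD('n)"
  proof -
    have "(2 * pi) powr (- real CARD('n) / 2) = ((2 * pi) powr (- (1 / 2))) powr real CARD('n)"
      by (simp add: powr_powr)
    also have "(2 * pi) powr (- (1 / 2)) = 1 / sqrt (2 * pi)"
      by (subst powr_minus_divide, subst powr_half_sqrt) simp_all
    finally show ?thesis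
      by (simp add: powr_realpow)
  qed
  moreover have "(\<Prod>b\<in>Basis. std_normal_density (x \<bullet> b))
      = (\<Prod>b\<in>(Basis :: (real ^ 'n) set). 1 / sqrt (2 * pi)) * (\<Prod>b\<in>Basis. exp (- (x \<bullet> b)\<^sup>2 / 2))"
    by (simp only: std_normal_density_def prod.distrib)
  ultimately show ?thesis
    by (simp add: gauss_density_def norm_power2_eq_sum_Basis exp_sum[symmetric] sum_negf
        sum_divide_distrib[symmetric])
qed

lemma nn_integral_std_normal_density: "(\<integral>\<^sup>+x. ennreal (std_normal_density x) \<partial>lborel) = 1"
  using std_normal_moment_even[of 0]
  by (subst nn_integral_eq_integral) (auto simp: has_bochner_integral_iff)

lemma nn_integral_std_normal_second_moment:
  "(\<integral>\<^sup>+x. ennreal (std_normal_density x * x\<^sup>2) \<partial>lborel) = 1"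
  using std_normal_moment_even[of 1]
  by (subst nn_integral_eq_integral) (auto simp: has_bochner_integral_iff)

lemma nn_integral_prod_Basis:
  fixes g :: "'a::euclidean_space \<Rightarrow> real \<Rightarrow> real"
  assumes "\<And>b. g b \<in> borel_measurable borel" "\<And>b x. g b x \<ge> 0"
  shows "(\<integral>\<^sup>+x. ennreal (\<Prod>b\<in>Basis. g b (x \<bullet> b)) \<partial>lborel)
       = (\<Prod>b\<in>Basis. \<integral>\<^sup>+t. ennreal (g b t) \<partial>lborel)"
proof -
  have "(\<integral>\<^sup>+x. (\<Prod>b\<in>Basis. ennreal (g b (x \<bullet> b))) \<partial>lborel)
       = (\<Prod>b\<in>Basis. \<integral>\<^sup>+t. ennreal (g b t) \<partial>lborel)"
    using assms by (intro nn_integral_lborel_prod) auto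
  then show ?thesis using assms(2) by (simp add: prod_ennreal)
qed

lemma emeasure_std_gaussian_space:
  "emeasure (std_gaussian :: (real ^ 'n::finite) measure) UNIV = 1"
proof -
  have "emeasure (std_gaussian :: (real ^ 'n) measure) UNIV = (\<integral>\<^sup>+x. 1 \<partial>(std_gaussian :: (real ^ 'n) measure))"
    by (simp add: space_std_gaussian)
  also have "\<dots> = (\<integral>\<^sup>+x. ennreal (gauss_density (x :: real ^ 'n)) \<partial>lborel)"
    by (subst nn_integral_std_gaussian) auto
  also have "\<dots> = 1"
    unfolding gauss_density_eq_prod
    by (subst nn_integral_prod_Basis[where g = "\<lambda>_. std_normal_density"])
       (simp_all add: nn_integral_std_normal_density)
  finally show ?thesis .
qed

lemma prob_space_std_gaussian: "prob_space (std_gaussian :: (real ^ 'n::finite) measure)"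
  by (rule prob_spaceI) (simp add: emeasure_std_gaussian_space space_std_gaussian)

lemma std_gaussian_second_moment:
  "(\<integral>\<^sup>+x. ennreal ((norm x)\<^sup>2) \<partial>(std_gaussian :: (real ^ 'n::finite) measure)) = of_nat CARD('n)"
proof -
  have *: "(\<integral>\<^sup>+x. ennreal (gauss_density (x :: real ^ 'n) * (x \<bullet> c)\<^sup>2) \<partial>lborel) = 1"
    if c: "c \<in> Basis" for c
  proof -
    define g where "g b t = std_normal_density t * (if b = c then t\<^sup>2 else 1)"
      for b :: "real ^ 'n" and t
    have "gauss_density x * (x \<bullet> c)\<^sup>2 = (\<Prod>b\<in>Basis. g b (x \<bullet> b))" for x
      unfolding gauss_density_eq_prod g_def prod.distrib
      using c by (simp add: prod.delta)
    moreover have "(\<integral>\<^sup>+t. ennreal (g b t) \<partial>lborel) = 1" for b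
      by (cases "b = c")
         (simp_all add: g_def nn_integral_std_normal_density nn_integral_std_normal_second_moment)
    moreover have "g b \<in> borel_measurable borel" for b
      unfolding g_def by measurable
    moreover have "g b t \<ge> 0" for b t by (simp add: g_def)
    ultimately show ?thesis
      by (simp add: nn_integral_prod_Basis)
  qed
  have "ennreal (gauss_density x) * ennreal ((norm x)\<^sup>2)
      = (\<Sum>c\<in>Basis. ennreal (gauss_density x * (x \<bullet> c)\<^sup>2))" for x :: "real ^ 'n"
  proof -
    have "gauss_density x * (norm x)\<^sup>2 = (\<Sum>c\<in>Basis. gauss_density x * (x \<bullet> c)\<^sup>2)"
      by (simp add: norm_power2_eq_sum_Basis sum_distrib_left)
    then show ?thesis
      using gauss_density_pos[of x] by (simp add: ennreal_mult'[symmetric] less_imp_le)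
  qed
  then show ?thesis
    by (subst nn_integral_std_gaussian) (simp_all add: nn_integral_sum *)
qed

text \<open>Jensen's inequality applied to the second moment; this is where the term sqrt d of the surface
area bound comes from.\<close>

lemma std_gaussian_first_moment:
  "(\<integral>\<^sup>+x. ennreal (norm x) \<partial>(std_gaussian :: (real ^ 'n::finite) measure)) \<le> ennreal (sqrt CARD('n))"
proof -
  define s where "s = sqrt (real CARD('n))"
  have s: "s > 0" by (simp add: s_def)
  have s2: "s * s = real CARD('n)" by (simp add: s_def)
  have meas: "(\<lambda>x. ennreal ((norm x)\<^sup>2)) \<in> borel_measurable (std_gaussian :: (real ^ 'n) measure)"
    by (rule borel_measurable_std_gaussian) simp
  \<comment> \<open>AM-GM for \<open>norm x\<^sup>2 / s\<close> and \<open>s\<close>; this choice of \<open>s\<close> makes the mean of the bound equal to sqrt d.\<close>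
  have "ennreal (norm x) \<le> ennreal (1 / (2 * s)) * ennreal ((norm x)\<^sup>2) + ennreal (s / 2)"
    for x :: "real ^ 'n"
  proof -
    have "0 \<le> (norm x - s)\<^sup>2" by simp
    then have "norm x \<le> 1 / (2 * s) * (norm x)\<^sup>2 + s / 2"
      using s by (simp add: field_simps power2_eq_square)
    then show ?thesis
      using s by (simp add: ennreal_mult[symmetric] ennreal_plus[symmetric] ennreal_leI del: ennreal_plus)
  qed
  then have "(\<integral>\<^sup>+x. ennreal (norm x) \<partial>(std_gaussian :: (real ^ 'n) measure))
     \<le> (\<integral>\<^sup>+x. ennreal (1 / (2 * s)) * ennreal ((norm x)\<^sup>2) + ennreal (s / 2)
          \<partial>(std_gaussian :: (real ^ 'n) measure))"
    by (intro nn_integral_mono)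
  also have "\<dots> = ennreal (1 / (2 * s)) * of_nat CARD('n) + ennreal (s / 2)"
    using meas by (simp add: nn_integral_add nn_integral_cmult std_gaussian_second_moment
        emeasure_std_gaussian_space space_std_gaussian)
  also have "\<dots> = ennreal (1 / (2 * s) * real CARD('n) + s / 2)"
    using s by (subst ennreal_plus, simp, simp, subst ennreal_mult)
      (simp_all add: ennreal_of_nat_eq_real_of_nat)
  also have "1 / (2 * s) * real CARD('n) + s / 2 = s"
    using s by (simp add: s2[symmetric] field_simps)
  finally show ?thesis by (simp add: s_def)
qed

section \<open>Contraction towards a point\<close>

text \<open>A lower bound for the factor by which a contraction with ratio \<open>c = r / (r + \<epsilon>)\<close> towards a point at
distance less than \<open>r + \<epsilon>\<close> changes Gaussian mass: the power of \<open>c\<close> is the Jacobian, and the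
exponential is the worst change of density when a point moves by at most \<open>\<epsilon>\<close>.\<close>

definition shrink_weight :: "real \<Rightarrow> real \<Rightarrow> (real ^ 'n::finite) \<Rightarrow> real" where
  "shrink_weight r \<epsilon> x = (r / (r + \<epsilon>)) ^ CARD('n) * exp (- (\<epsilon> * norm x + \<epsilon>\<^sup>2 / 2))"

lemma shrink_weight_measurable [measurable]: "shrink_weight r \<epsilon> \<in> borel_measurable borel"
  unfolding shrink_weight_def by measurable

lemma gauss_density_contraction:
  fixes x a :: "real ^ 'n::finite"
  assumes "r > 0" "\<epsilon> > 0" "dist a x < r + \<epsilon>"
  defines "c \<equiv> r / (r + \<epsilon>)"
  shows "gauss_density x * shrink_weight r \<epsilon> x \<le> c ^ CARD('n) * gauss_density ((1 - c) *\<^sub>R a + c *\<^sub>R x)"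
proof -
  define y where "y = (1 - c) *\<^sub>R a + c *\<^sub>R x"
  have c: "1 - c = \<epsilon> / (r + \<epsilon>)" "c \<ge> 0"
    using assms by (auto simp: c_def field_simps)
  have "y - x = (1 - c) *\<^sub>R (a - x)"
    by (simp add: y_def algebra_simps)
  then have "norm (y - x) = (1 - c) * dist a x"
    using c assms by (simp add: dist_norm)
  also have "\<dots> \<le> \<epsilon>"
  proof -
    have "(1 - c) * dist a x \<le> \<epsilon> / (r + \<epsilon>) * (r + \<epsilon>)"
      unfolding c(1) using assms by (intro mult_left_mono) auto
    then show ?thesis using assms by simp
  qed
  finally have "norm y \<le> norm x + \<epsilon>"
    using norm_triangle_sub[of y x] by simp
  then have "(norm y)\<^sup>2 \<le> (norm x + \<epsilon>)\<^sup>2"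
    by (intro power_mono) auto
  then have "- (norm x)\<^sup>2 / 2 + - (\<epsilon> * norm x + \<epsilon>\<^sup>2 / 2) \<le> - (norm y)\<^sup>2 / 2"
    by (simp add: power2_sum algebra_simps)
  then have "exp (- (norm x)\<^sup>2 / 2) * exp (- (\<epsilon> * norm x + \<epsilon>\<^sup>2 / 2)) \<le> exp (- (norm y)\<^sup>2 / 2)"
    by (simp only: exp_add[symmetric] exp_le_cancel_iff)
  then have "((2 * pi) powr (- real CARD('n) / 2) * c ^ CARD('n))
      * (exp (- (norm x)\<^sup>2 / 2) * exp (- (\<epsilon> * norm x + \<epsilon>\<^sup>2 / 2)))
     \<le> ((2 * pi) powr (- real CARD('n) / 2) * c ^ CARD('n)) * exp (- (norm y)\<^sup>2 / 2)"
    using c by (intro mult_left_mono) auto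
  then show ?thesis
    unfolding gauss_density_def shrink_weight_def c_def[symmetric] y_def[symmetric]
    by (simp only: mult_ac)
qed

text \<open>The contraction \<open>x \<mapsto> a + c (x - a)\<close> carries \<open>V \<inter> ball a (r + \<epsilon>)\<close> into \<open>V \<inter> ball a r\<close>, because
\<open>V\<close> is star-shaped about \<open>a\<close>. The affine change of variables therefore compares the two masses.\<close>

lemma star_shaped_gaussian_growth:
  fixes a :: "real ^ 'n::finite"
  assumes "r > 0" "\<epsilon> > 0" and V: "V \<in> sets borel"
    and star: "\<And>x c. x \<in> V \<Longrightarrow> 0 \<le> c \<Longrightarrow> c \<le> 1 \<Longrightarrow> (1 - c) *\<^sub>R a + c *\<^sub>R x \<in> V"
  shows "emeasure (density std_gaussian (\<lambda>x. ennreal (shrink_weight r \<epsilon> x))) (V \<inter> ball a (r + \<epsilon>))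
    \<le> emeasure std_gaussian (V \<inter> ball a r)"
proof -
  define c where "c = r / (r + \<epsilon>)"
  have c: "0 < c" "c \<le> 1" using assms by (auto simp: c_def)
  have [measurable]: "indicator (V \<inter> ball a s) \<in> borel_measurable borel" for s
    using V by (intro borel_measurable_indicator sets.Int) auto
  have w: "(\<lambda>x. ennreal (shrink_weight r \<epsilon> x)) \<in> borel_measurable std_gaussian"
    by (rule borel_measurable_std_gaussian) simp
  \<comment> \<open>the contraction towards \<open>a\<close>, and the Gaussian density of the smaller set\<close>
  let ?T = "\<lambda>x. (1 - c) *\<^sub>R a + c *\<^sub>R x"
  let ?h = "\<lambda>y. ennreal (gauss_density y) * indicator (V \<inter> ball a r) y"
  have "emeasure (density std_gaussian (\<lambda>x. ennreal (shrink_weight r \<epsilon> x))) (V \<inter> ball a (r + \<epsilon>))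
      = (\<integral>\<^sup>+x. ennreal (shrink_weight r \<epsilon> x) * indicator (V \<inter> ball a (r + \<epsilon>)) x \<partial>std_gaussian)"
    using V w by (intro emeasure_density) (auto intro: borel_set_std_gaussian)
  also have "\<dots> = (\<integral>\<^sup>+x. ennreal (gauss_density x)
        * (ennreal (shrink_weight r \<epsilon> x) * indicator (V \<inter> ball a (r + \<epsilon>)) x) \<partial>lborel)"
    by (intro nn_integral_std_gaussian) measurable
  also have "\<dots> \<le> (\<integral>\<^sup>+x. ennreal (\<bar>c\<bar> ^ DIM(real ^ 'n)) * ?h (?T x) \<partial>lborel)"
  proof (rule nn_integral_mono)
    fix x
    show "ennreal (gauss_density x) * (ennreal (shrink_weight r \<epsilon> x) * indicator (V \<inter> ball a (r + \<epsilon>)) x)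
      \<le> ennreal (\<bar>c\<bar> ^ DIM(real ^ 'n)) * ?h (?T x)"
    proof (cases "x \<in> V \<inter> ball a (r + \<epsilon>)")
      case True
      have "dist a (?T x) = c * dist a x"
      proof -
        have "a - ?T x = c *\<^sub>R (a - x)" by (simp add: algebra_simps)
        then show ?thesis using c by (simp add: dist_norm)
      qed
      also have "\<dots> < c * (r + \<epsilon>)"
        using True c by simp
      also have "\<dots> = r"
        using assms by (simp add: c_def)
      finally have "?T x \<in> V \<inter> ball a r"
        using star True c by simp
      moreover have "ennreal (gauss_density x) * ennreal (shrink_weight r \<epsilon> x)
          \<le> ennreal (c ^ CARD('n)) * ennreal (gauss_density (?T x))"
        using gauss_density_contraction[of r \<epsilon> a x] True assms gauss_density_pos[of x]
          gauss_density_pos[of "?T x"] c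
        by (simp add: ennreal_mult'[symmetric] less_imp_le c_def ennreal_leI)
      ultimately show ?thesis
        using True c by simp
    qed simp
  qed
  also have "\<dots> = (\<integral>\<^sup>+y. ?h y \<partial>density (distr lborel borel ?T) (\<lambda>_. ennreal (\<bar>c\<bar> ^ DIM(real ^ 'n))))"
    by (simp add: nn_integral_density nn_integral_distr)
  also have "\<dots> = (\<integral>\<^sup>+y. ?h y \<partial>lborel)"
    using c lborel_affine[of c "(1 - c) *\<^sub>R a"] by simp
  also have "\<dots> = (\<integral>\<^sup>+y. indicator (V \<inter> ball a r) y \<partial>std_gaussian)"
    by (intro nn_integral_std_gaussian[symmetric]) measurable
  also have "\<dots> = emeasure std_gaussian (V \<inter> ball a r)"
    using V by (intro nn_integral_indicator borel_set_std_gaussian) auto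
  finally show ?thesis .
qed

section \<open>Finitely many centres: Voronoi cells\<close>

text \<open>Ties between nearest centres are broken in favour of the smallest index, so that the cells
partition the space exactly, with no overlaps on common faces. If a centre is repeated, the cell of
every later copy is empty; the sequence may thus be an arbitrary enumeration.\<close>

definition voronoi_cell :: "nat \<Rightarrow> (nat \<Rightarrow> real ^ 'n::finite) \<Rightarrow> nat \<Rightarrow> (real ^ 'n) set" where
  "voronoi_cell n q i = {x. \<forall>j<n. dist x (q i) \<le> dist x (q j) \<and> (j < i \<longrightarrow> dist x (q i) < dist x (q j))}"

lemma borel_voronoi_cell: "voronoi_cell n q i \<in> sets borel"
  unfolding voronoi_cell_def by measurable

text \<open>Moving towards \<open>q i\<close> by some length decreases the distance to \<open>q i\<close> by exactly that length and the
distance to any other centre by at most that length. So both the weak and the strict comparisons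
that define the cell persist.\<close>

lemma voronoi_cell_star_shaped:
  assumes "x \<in> voronoi_cell n q i" "0 \<le> c" "c \<le> 1"
  shows "(1 - c) *\<^sub>R q i + c *\<^sub>R x \<in> voronoi_cell n q i"
proof -
  let ?y = "(1 - c) *\<^sub>R q i + c *\<^sub>R x"
  have "?y - q i = c *\<^sub>R (x - q i)" "x - ?y = (1 - c) *\<^sub>R (x - q i)"
    by (simp_all add: algebra_simps)
  then have "dist ?y (q i) = c * dist x (q i)" "dist x ?y = (1 - c) * dist x (q i)"
    using assms by (simp_all add: dist_norm)
  then have "dist x (q i) = dist ?y (q i) + dist x ?y"
    by (simp add: algebra_simps)
  moreover have "dist x (q j) \<le> dist ?y (q j) + dist x ?y" for j
    using dist_triangle[of x "q j" ?y] by simp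
  ultimately show ?thesis
    using assms unfolding voronoi_cell_def by (smt (verit) mem_Collect_eq)
qed

lemma disjoint_voronoi_cells: "disjoint_family_on (voronoi_cell n q) {..<n}"
proof -
  have "voronoi_cell n q i \<inter> voronoi_cell n q j = {}" if "i < j" "j < n" for i j
    using that unfolding voronoi_cell_def by (fastforce simp: not_less[symmetric])
  then show ?thesis
    unfolding disjoint_family_on_def by (metis inf_commute lessThan_iff linorder_neqE_nat)
qed

lemma voronoi_cells_cover:
  assumes "j < n"
  obtains i where "i < n" "x \<in> voronoi_cell n q i"
proof -
  define P where "P i \<longleftrightarrow> i < n \<and> (\<forall>j<n. dist x (q i) \<le> dist x (q j))" for i
  obtain i where "is_arg_min (\<lambda>i. dist x (q i)) (\<lambda>i. i \<in> {..<n}) i"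
    using ex_is_arg_min_if_finite[of "{..<n}" "\<lambda>i. dist x (q i)"] assms by auto
  then have "P i"
    by (auto simp: is_arg_min_linorder P_def)
  \<comment> \<open>the tie-breaking rule selects the first nearest centre\<close>
  define k where "k = (LEAST i. P i)"
  have k: "k < n" "\<And>j. j < n \<Longrightarrow> dist x (q k) \<le> dist x (q j)"
    using LeastI[of P, OF \<open>P i\<close>] by (auto simp: k_def P_def)
  have "dist x (q k) < dist x (q j)" if "j < k" for j
  proof (rule ccontr)
    assume "\<not> dist x (q k) < dist x (q j)"
    then have "\<And>l. l < n \<Longrightarrow> dist x (q j) \<le> dist x (q l)"
      using k(2) by (meson not_less order_trans)
    then have "P j"
      using that k(1) by (simp add: P_def)
    then show False
      using that not_less_Least[of j P] by (simp add: k_def)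
  qed
  then show ?thesis
    using k by (intro that[of k]) (auto simp: voronoi_cell_def)
qed

text \<open>Contracting each Voronoi cell towards its own centre shrinks the whole union at once. The
images stay in disjoint cells, so no mass of the smaller union is counted twice.\<close>

lemma finite_union_balls_gaussian_growth:
  fixes q :: "nat \<Rightarrow> real ^ 'n::finite"
  assumes "r > 0" "\<epsilon> > 0"
  shows "emeasure (density std_gaussian (\<lambda>x. ennreal (shrink_weight r \<epsilon> x))) (\<Union>i<n. ball (q i) (r + \<epsilon>))
    \<le> emeasure std_gaussian (\<Union>i<n. ball (q i) r)"
proof -
  let ?\<mu> = "density std_gaussian (\<lambda>x. ennreal (shrink_weight r \<epsilon> x :: real))"
  let ?V = "voronoi_cell n q"
  have borel: "S \<in> sets std_gaussian" "S \<in> sets ?\<mu>" if "S \<in> sets borel" for S :: "(real ^ 'n) set"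
    using that by (simp_all add: borel_set_std_gaussian)
  have cells: "?V i \<inter> ball (q i) s \<in> sets borel" for i s
    by (intro sets.Int borel_voronoi_cell borel_open) simp
  have disj: "disjoint_family_on (\<lambda>i. ?V i \<inter> ball (q i) s) {..<n}" for s
    using disjoint_voronoi_cells[of n q] unfolding disjoint_family_on_def by blast
  have "(\<Union>i<n. ball (q i) (r + \<epsilon>)) \<subseteq> (\<Union>i<n. ?V i \<inter> ball (q i) (r + \<epsilon>))"
  proof
    fix x assume "x \<in> (\<Union>i<n. ball (q i) (r + \<epsilon>))"
    then obtain j where j: "j < n" "dist (q j) x < r + \<epsilon>" by auto
    then obtain i where i: "i < n" "x \<in> ?V i" using voronoi_cells_cover by blast
    then have "dist x (q i) \<le> dist x (q j)" using j by (simp add: voronoi_cell_def)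
    then show "x \<in> (\<Union>i<n. ?V i \<inter> ball (q i) (r + \<epsilon>))"
      using i j by (auto simp: dist_commute)
  qed
  then have "emeasure ?\<mu> (\<Union>i<n. ball (q i) (r + \<epsilon>)) \<le> emeasure ?\<mu> (\<Union>i<n. ?V i \<inter> ball (q i) (r + \<epsilon>))"
    by (intro emeasure_mono borel sets.finite_UN cells) auto
  also have "\<dots> = (\<Sum>i<n. emeasure ?\<mu> (?V i \<inter> ball (q i) (r + \<epsilon>)))"
    using disj by (intro sum_emeasure[symmetric]) (auto intro!: borel cells)
  also have "\<dots> \<le> (\<Sum>i<n. emeasure std_gaussian (?V i \<inter> ball (q i) r))"
    using assms by (intro sum_mono star_shaped_gaussian_growth borel_voronoi_cell voronoi_cell_star_shaped)
  also have "\<dots> = emeasure std_gaussian (\<Union>i<n. ?V i \<inter> ball (q i) r)"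
    using disj by (intro sum_emeasure) (auto intro!: borel cells)
  also have "\<dots> \<le> emeasure std_gaussian (\<Union>i<n. ball (q i) r)"
    by (intro emeasure_mono borel) auto
  finally show ?thesis .
qed

section \<open>Growth of neighbourhoods of arbitrary sets\<close>

definition open_nbhd :: "(real ^ 'n::finite) set \<Rightarrow> real \<Rightarrow> (real ^ 'n) set" where
  "open_nbhd A s = (\<Union>a\<in>A. ball a s)"

lemma borel_open_nbhd [simp]: "open_nbhd A s \<in> sets borel"
  unfolding open_nbhd_def by (intro borel_open) auto

text \<open>By the Lindeloef property countably many of the balls of radius \<open>r + \<epsilon>\<close> suffice to cover the larger
neighbourhood; it is the increasing limit of finite unions, for each of which the smaller union
lies in \<open>open_nbhd A r\<close>.\<close>

lemma open_nbhd_gaussian_growth_weighted: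
  fixes A :: "(real ^ 'n::finite) set"
  assumes "r > 0" "\<epsilon> > 0"
  shows "emeasure (density std_gaussian (\<lambda>x. ennreal (shrink_weight r \<epsilon> x))) (open_nbhd A (r + \<epsilon>))
    \<le> emeasure std_gaussian (open_nbhd A r)"
proof (cases "A = {}")
  case False
  let ?\<mu> = "density std_gaussian (\<lambda>x. ennreal (shrink_weight r \<epsilon> x :: real))"
  obtain F where F: "F \<subseteq> (\<lambda>a. ball a (r + \<epsilon>)) ` A" "countable F"
      "\<Union>F = \<Union>((\<lambda>a. ball a (r + \<epsilon>)) ` A)"
    by (rule Lindelof[of "(\<lambda>a. ball a (r + \<epsilon>)) ` A"]) auto
  then obtain D where D: "D \<subseteq> A" "countable D" "F = (\<lambda>a. ball a (r + \<epsilon>)) ` D"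
    by (metis countable_subset_image)
  have "D \<noteq> {}"
    using D F False assms by (auto simp: image_iff)
  define q where "q = from_nat_into D"
  have q: "range q = D"
    unfolding q_def using D \<open>D \<noteq> {}\<close> by (simp add: range_from_nat_into)
  have "open_nbhd A (r + \<epsilon>) = (\<Union>i. ball (q i) (r + \<epsilon>))"
    using F(3) D(3) q unfolding open_nbhd_def by force
  also have "\<dots> = (\<Union>n. \<Union>i<n. ball (q i) (r + \<epsilon>))"
    by blast
  finally have "emeasure ?\<mu> (open_nbhd A (r + \<epsilon>)) = emeasure ?\<mu> (\<Union>n. \<Union>i<n. ball (q i) (r + \<epsilon>))"
    by simp
  also have "\<dots> = (SUP n. emeasure ?\<mu> (\<Union>i<n. ball (q i) (r + \<epsilon>)))"
    by (intro SUP_emeasure_incseq[symmetric])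
       (auto simp: incseq_def intro!: borel_set_std_gaussian, force)
  also have "\<dots> \<le> emeasure std_gaussian (open_nbhd A r)"
  proof (rule SUP_least)
    fix n
    have "emeasure ?\<mu> (\<Union>i<n. ball (q i) (r + \<epsilon>)) \<le> emeasure std_gaussian (\<Union>i<n. ball (q i) r)"
      using assms by (rule finite_union_balls_gaussian_growth)
    also have "\<dots> \<le> emeasure std_gaussian (open_nbhd A r)"
      using D(1) q
      by (intro emeasure_mono borel_set_std_gaussian borel_open_nbhd) (auto simp: open_nbhd_def)
    finally show "emeasure ?\<mu> (\<Union>i<n. ball (q i) (r + \<epsilon>)) \<le> emeasure std_gaussian (open_nbhd A r)" .
  qed
  finally show ?thesis .
qed (simp add: open_nbhd_def)

text \<open>Linearization in \<open>\<epsilon>\<close>: Bernoulli's inequality for the Jacobian, \<open>exp (-t) \<ge> 1 - t\<close> for the density,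
and \<open>1 - u v \<le> (1 - u) + (1 - v)\<close> for factors in the unit interval.\<close>

lemma shrink_weight_lower_bound:
  fixes x :: "real ^ 'n::finite"
  assumes "r > 0" "\<epsilon> > 0"
  shows "1 \<le> shrink_weight r \<epsilon> x + (\<epsilon> * (CARD('n) / r) + \<epsilon> * norm x + \<epsilon>\<^sup>2 / 2)"
proof -
  define u where "u = (r / (r + \<epsilon>)) ^ CARD('n)"
  define v where "v = exp (- (\<epsilon> * norm x + \<epsilon>\<^sup>2 / 2))"
  have "1 + real CARD('n) * (- (\<epsilon> / (r + \<epsilon>))) \<le> (1 + (- (\<epsilon> / (r + \<epsilon>)))) ^ CARD('n)"
    using assms by (intro Bernoulli_inequality) simp
  also have "1 + (- (\<epsilon> / (r + \<epsilon>))) = r / (r + \<epsilon>)"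
    using assms by (simp add: field_simps)
  finally have "1 - u \<le> real CARD('n) * (\<epsilon> / (r + \<epsilon>))"
    by (simp add: u_def)
  also have "\<dots> \<le> real CARD('n) * (\<epsilon> / r)"
    using assms by (intro mult_left_mono divide_left_mono) auto
  finally have u: "1 - u \<le> \<epsilon> * (CARD('n) / r)"
    by (simp add: mult.commute)
  have v: "1 - v \<le> \<epsilon> * norm x + \<epsilon>\<^sup>2 / 2"
    using exp_ge_add_one_self[of "- (\<epsilon> * norm x + \<epsilon>\<^sup>2 / 2)"] unfolding v_def by linarith
  have "u \<le> 1"
    using assms unfolding u_def by (intro power_le_one) auto
  moreover have "v \<le> 1"
  proof -
    have "0 \<le> \<epsilon> * norm x + \<epsilon>\<^sup>2 / 2"
      using assms by (intro add_nonneg_nonneg) auto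
    then show ?thesis
      unfolding v_def exp_le_one_iff by linarith
  qed
  ultimately have "0 \<le> (1 - u) * (1 - v)" by simp
  then have "1 \<le> u * v + (1 - u) + (1 - v)" by (simp add: algebra_simps)
  then show ?thesis
    using u v unfolding shrink_weight_def u_def[symmetric] v_def[symmetric] by linarith
qed

text \<open>The mass that the weight loses has mean at most \<open>\<epsilon> d / r + \<epsilon> E|x| + \<epsilon>\<^sup>2 / 2\<close>.\<close>

lemma open_nbhd_gaussian_growth:
  fixes A :: "(real ^ 'n::finite) set"
  assumes "r > 0" "\<epsilon> > 0"
  shows "measure std_gaussian (open_nbhd A (r + \<epsilon>)) \<le> measure std_gaussian (open_nbhd A r)
    + \<epsilon> * (CARD('n) / r + sqrt CARD('n) + \<epsilon> / 2)"
proof -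
  let ?\<gamma> = "std_gaussian :: (real ^ 'n) measure"
  interpret prob_space ?\<gamma> by (rule prob_space_std_gaussian)
  let ?\<mu> = "density ?\<gamma> (\<lambda>x. ennreal (shrink_weight r \<epsilon> x :: real))"
  let ?U = "open_nbhd A (r + \<epsilon>)"
  define k where "k = \<epsilon> * (CARD('n) / r) + \<epsilon>\<^sup>2 / 2"
  have k: "k \<ge> 0" using assms by (simp add: k_def)
  have U: "?U \<in> sets ?\<gamma>" by (simp add: borel_set_std_gaussian)
  have w: "(\<lambda>x. ennreal (shrink_weight r \<epsilon> x)) \<in> borel_measurable ?\<gamma>"
      and nm: "(\<lambda>x. ennreal (norm x)) \<in> borel_measurable ?\<gamma>"
    by (rule borel_measurable_std_gaussian; simp)+
  have "emeasure ?\<gamma> ?U = (\<integral>\<^sup>+x. indicator ?U x \<partial>?\<gamma>)"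
    using U by simp
  also have "\<dots> \<le> (\<integral>\<^sup>+x. ennreal (shrink_weight r \<epsilon> x) * indicator ?U x
      + (ennreal \<epsilon> * ennreal (norm x) + ennreal k) \<partial>?\<gamma>)"
  proof (rule nn_integral_mono)
    fix x :: "real ^ 'n"
    have w0: "shrink_weight r \<epsilon> x \<ge> 0"
      using assms by (simp add: shrink_weight_def)
    have "1 \<le> shrink_weight r \<epsilon> x + (\<epsilon> * norm x + k)"
      using shrink_weight_lower_bound[OF assms, of x] by (simp add: k_def)
    then have "ennreal 1 \<le> ennreal (shrink_weight r \<epsilon> x + (\<epsilon> * norm x + k))"
      by (rule ennreal_leI)
    also have "\<dots> = ennreal (shrink_weight r \<epsilon> x) + (ennreal \<epsilon> * ennreal (norm x) + ennreal k)"
      using assms w0 k by (simp add: ennreal_mult)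
    finally show "indicator ?U x \<le> ennreal (shrink_weight r \<epsilon> x) * indicator ?U x
      + (ennreal \<epsilon> * ennreal (norm x) + ennreal k)"
      by (cases "x \<in> ?U") simp_all
  qed
  also have "\<dots> = emeasure ?\<mu> ?U + (ennreal \<epsilon> * (\<integral>\<^sup>+x. ennreal (norm x) \<partial>?\<gamma>) + ennreal k)"
    using U w nm
    by (simp add: nn_integral_add nn_integral_cmult emeasure_density emeasure_std_gaussian_space
        space_std_gaussian)
  also have "\<dots> \<le> emeasure ?\<gamma> (open_nbhd A r) + (ennreal \<epsilon> * ennreal (sqrt CARD('n)) + ennreal k)"
    using assms
    by (intro add_mono mult_left_mono open_nbhd_gaussian_growth_weighted std_gaussian_first_moment) auto
  also have "ennreal \<epsilon> * ennreal (sqrt CARD('n)) + ennreal k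
      = ennreal (\<epsilon> * (CARD('n) / r + sqrt CARD('n) + \<epsilon> / 2))"
    using assms k by (simp add: ennreal_mult[symmetric] ennreal_plus[symmetric] k_def
        algebra_simps power2_eq_square del: ennreal_plus)
  finally show ?thesis
    using assms by (simp add: emeasure_eq_measure ennreal_plus[symmetric] del: ennreal_plus)
qed

section \<open>Closed neighbourhoods and surface area\<close>

lemma parallel_set_eq_UN_cball:
  fixes A :: "(real ^ 'n::finite) set"
  assumes "s > 0"
  shows "parallel_set A s = (\<Union>a\<in>A. cball a s)"
proof -
  have ball: "(\<lambda>x. s *\<^sub>R x) ` cball 0 1 = cball (0 :: real ^ 'n) s"
    using cball_scale[of s "0 :: real ^ 'n" 1] assms by simp
  have "parallel_set A s = (\<Union>a\<in>A. (+) a ` cball 0 s)"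
    unfolding parallel_set_def ball by (simp only: set_plus_def) blast
  then show ?thesis
    using cball_translation[of _ "0 :: real ^ 'n" s] by simp
qed

lemma open_nbhd_subset_parallel_set: "s > 0 \<Longrightarrow> open_nbhd A s \<subseteq> parallel_set A s"
  by (force simp: parallel_set_eq_UN_cball open_nbhd_def)

lemma parallel_set_subset_open_nbhd: "0 < s \<Longrightarrow> s < t \<Longrightarrow> parallel_set A s \<subseteq> open_nbhd A t"
  by (force simp: parallel_set_eq_UN_cball open_nbhd_def)

lemma parallel_set_parallel_set_subset:
  assumes "r > 0" "\<epsilon> > 0"
  shows "parallel_set (parallel_set A r) \<epsilon> \<subseteq> parallel_set A (r + \<epsilon>)"
proof
  fix x assume "x \<in> parallel_set (parallel_set A r) \<epsilon>"
  then obtain a y where "a \<in> A" "dist a y \<le> r" "dist y x \<le> \<epsilon>"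
    using assms by (auto simp: parallel_set_eq_UN_cball)
  moreover from this have "dist a x \<le> r + \<epsilon>"
    using dist_triangle[of a x y] by linarith
  ultimately show "x \<in> parallel_set A (r + \<epsilon>)"
    using assms by (auto simp: parallel_set_eq_UN_cball)
qed

text \<open>The closed neighbourhood lies in every larger open one, and by the growth estimate the mass of
the open neighbourhoods does not jump at \<open>s\<close>. By completeness of the measure this also makes
\<open>parallel_set A s\<close> measurable.\<close>

lemma parallel_set_boundary_null:
  fixes A :: "(real ^ 'n::finite) set"
  assumes "s > 0"
  shows "parallel_set A s - open_nbhd A s \<in> null_sets std_gaussian"
proof -
  let ?\<gamma> = "std_gaussian :: (real ^ 'n) measure"
  interpret prob_space ?\<gamma> by (rule prob_space_std_gaussian)
  let ?\<delta> = "\<lambda>k. inverse (real (Suc k))"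
  \<comment> \<open>a Borel set that contains the difference, whose own measurability is not yet known\<close>
  define N where "N = (\<Inter>k. open_nbhd A (s + ?\<delta> k)) - open_nbhd A s"
  have N: "N \<in> sets ?\<gamma>"
    unfolding N_def by (intro sets.Diff sets.countable_INT borel_set_std_gaussian borel_open_nbhd) auto
  have "measure ?\<gamma> N \<le> ?\<delta> k * (CARD('n) / s + sqrt CARD('n) + ?\<delta> k / 2)" for k
  proof -
    have "measure ?\<gamma> N + measure ?\<gamma> (open_nbhd A s) = measure ?\<gamma> (N \<union> open_nbhd A s)"
      by (intro finite_measure_Union[symmetric] N borel_set_std_gaussian borel_open_nbhd)
         (auto simp: N_def)
    also have "\<dots> \<le> measure ?\<gamma> (open_nbhd A (s + ?\<delta> k))"
    proof (intro finite_measure_mono borel_set_std_gaussian borel_open_nbhd)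
      have "open_nbhd A s \<subseteq> open_nbhd A (s + ?\<delta> k)"
        unfolding open_nbhd_def by (intro UN_mono subset_ball) simp_all
      then show "N \<union> open_nbhd A s \<subseteq> open_nbhd A (s + ?\<delta> k)"
        by (auto simp: N_def)
    qed
    also have "\<dots> \<le> measure ?\<gamma> (open_nbhd A s) + ?\<delta> k * (CARD('n) / s + sqrt CARD('n) + ?\<delta> k / 2)"
      using assms by (intro open_nbhd_gaussian_growth) simp_all
    finally show ?thesis by simp
  qed
  moreover have "(\<lambda>k. ?\<delta> k * (CARD('n) / s + sqrt CARD('n) + ?\<delta> k / 2))
      \<longlonglongrightarrow> 0 * (CARD('n) / s + sqrt CARD('n) + 0 / 2)"
    by (intro tendsto_intros LIMSEQ_inverse_real_of_nat) simp_all
  ultimately have "measure ?\<gamma> N \<le> 0 * (CARD('n) / s + sqrt CARD('n) + 0 / 2)"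
    by (intro LIMSEQ_le_const) auto
  then have "measure ?\<gamma> N = 0"
    using measure_nonneg[of ?\<gamma> N] by simp
  then have "N \<in> null_sets ?\<gamma>"
    using N by (intro null_setsI) (simp_all add: emeasure_eq_measure)
  moreover have "parallel_set A s - open_nbhd A s \<subseteq> N"
    using parallel_set_subset_open_nbhd[of s "s + ?\<delta> k" A for k] assms by (auto simp: N_def)
  ultimately show ?thesis
    unfolding std_gaussian_eq_completion by (rule null_sets_completion_subset[rotated])
qed

lemma measure_parallel_set:
  assumes "s > 0"
  shows "parallel_set A s \<in> sets std_gaussian"
    and "measure std_gaussian (parallel_set A s) = measure std_gaussian (open_nbhd A s)"
proof -
  have *: "parallel_set A s = open_nbhd A s \<union> (parallel_set A s - open_nbhd A s)"
    using open_nbhd_subset_parallel_set[OF assms, of A] by blast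
  have U: "open_nbhd A s \<in> sets std_gaussian"
    by (simp add: borel_set_std_gaussian)
  show "parallel_set A s \<in> sets std_gaussian"
    using U parallel_set_boundary_null[OF assms, of A] by (metis * null_setsD2 sets.Un)
  show "measure std_gaussian (parallel_set A s) = measure std_gaussian (open_nbhd A s)"
    using U parallel_set_boundary_null[OF assms, of A] by (subst *) (rule measure_Un_null_set)
qed

lemma parallel_set_gaussian_growth:
  fixes A :: "(real ^ 'n::finite) set"
  assumes "r > 0" "\<epsilon> > 0"
  shows "measure std_gaussian (parallel_set (parallel_set A r) \<epsilon>)
      \<le> measure std_gaussian (parallel_set A r) + \<epsilon> * (CARD('n) / r + sqrt CARD('n) + \<epsilon> / 2)"
proof -
  interpret prob_space "std_gaussian :: (real ^ 'n) measure" by (rule prob_space_std_gaussian)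
  have "measure std_gaussian (parallel_set (parallel_set A r) \<epsilon>)
      \<le> measure std_gaussian (parallel_set A (r + \<epsilon>))"
    using assms by (intro finite_measure_mono parallel_set_parallel_set_subset measure_parallel_set) auto
  then show ?thesis
    using open_nbhd_gaussian_growth[OF assms, of A] assms by (simp add: measure_parallel_set)
qed

text \<open>The two terms are the cost of the Jacobian and of the change of density under the contraction.
The claimed bound follows since each term is at most \<open>d max (sqrt d) (1 / r)\<close>.\<close>

theorem gaussian_upper_surface_area_parallel_set_le:
  fixes A :: "(real ^ 'n::finite) set"
  assumes "r > 0"
  shows "gaussian_upper_surface_area (parallel_set A r) \<le> ereal (CARD('n) / r + sqrt CARD('n))"
proof -
  let ?K = "CARD('n) / r + sqrt CARD('n)"
  let ?q = "\<lambda>\<epsilon>. (measure std_gaussian (parallel_set (parallel_set A r) \<epsilon>)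
      - measure std_gaussian (parallel_set A r)) / \<epsilon>"
  have "?q \<epsilon> \<le> ?K + \<epsilon> / 2" if "\<epsilon> > 0" for \<epsilon>
    using parallel_set_gaussian_growth[OF assms that, of A] that
    by (simp add: divide_le_eq mult.commute)
  then have "eventually (\<lambda>\<epsilon>. ereal (?q \<epsilon>) \<le> ereal (?K + \<epsilon> / 2)) (at_right 0)"
    by (auto simp: eventually_at_filter)
  then have "gaussian_upper_surface_area (parallel_set A r)
      \<le> Limsup (at_right 0) (\<lambda>\<epsilon>. ereal (?K + \<epsilon> / 2))"
    unfolding gaussian_upper_surface_area_def by (rule Limsup_mono)
  also have "\<dots> = ereal (?K + 0 / 2)"
    by (intro lim_imp_Limsup tendsto_ereal tendsto_intros) simp_all
  finally show ?thesis by simp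
qed

theorem theorem2:
  fixes A :: "(real ^ 'n::finite) set" and r :: real
  assumes "r > 0" and "A \<in> sets borel"
  shows "gaussian_upper_surface_area (parallel_set A r)
    \<le> ereal (18 * real CARD('n) * max (sqrt (real CARD('n))) (inverse r))"
proof -
  let ?d = "real CARD('n)" and ?M = "max (sqrt (real CARD('n))) (inverse r)"
  have "?d / r \<le> ?d * ?M"
    unfolding divide_inverse by (intro mult_left_mono) auto
  moreover have "sqrt ?d \<le> ?d * ?M"
  proof -
    have "1 * sqrt ?d \<le> ?d * ?M"
      by (intro mult_mono) auto
    then show ?thesis by simp
  qed
  moreover have "0 \<le> ?d * ?M"
    by (simp add: le_max_iff_disj)
  ultimately have "?d / r + sqrt ?d \<le> 18 * ?d * ?M"
    by linarith
  then show ?thesis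
    using gaussian_upper_surface_area_parallel_set_le[OF assms(1), of A]
    by (meson ereal_less_eq(3) order_trans)
qed

end
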